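(* Let $K$ be a field. For $m\ge 2$ let $I_m=(x_1x_2,x_2x_3,\ldots,x_{m-1}x_m)\subset K[x_1,\ldots,x_m]$, and for $m\ge 3$ let $J_m=I_m+(x_mx_1)\subset K[x_1,\ldots,x_m]$. For all $n\ge 6$ we have $$\operatorname{hdepth}(J_n/I_n)=2+\operatorname{hdepth}(K[x_1,\ldots,x_{n-4}]/I_{n-4})\ge\left\lceil\frac{n+2}{3}\right\rceil.$$
   Context: Polynomial rings have the standard grading. For a nonzero finitely generated graded module $M$ over a standard graded polynomial ring over $K$, with Hilbert series $H_M(t)=\sum_i \dim_K(M_i)t^i$, the Hilbert depth is $\operatorname{hdepth}(M)=\max\{r\ge 0 : (1-t)^rH_M(t)\text{ has only nonnegative coefficients}\}$ (equivalently, the maximal depth of a finitely generated graded module with the same Hilbert series as $M$). *)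

theory Defs
  imports
    "HOL-Algebra.Embedded_Algebras"
    "HOL-Algebra.QuotRing"
    "HOL-Library.Poly_Mapping"
    "HOL-Computational_Algebra.Formal_Power_Series"
begin

section \<open>The polynomial rings \<open>K[x\<^sub>1, \<dots>, x\<^sub>m]\<close>\<close>

text \<open>
  A polynomial is a finitely supported map from exponent vectors to coefficients. All the rings
  \<open>K[x\<^sub>1, \<dots>, x\<^sub>m]\<close> live in the same type, in the variables \<open>x\<^sub>i\<close> with \<open>i :: nat\<close>; the number \<open>m\<close> of
  variables is recorded in the carrier.
\<close>

type_synonym 'k mpoly = "(nat \<Rightarrow>\<^sub>0 nat) \<Rightarrow>\<^sub>0 'k"

definition poly_ring :: "nat \<Rightarrow> 'k::field mpoly ring" where
  "poly_ring m =
    \<lparr>carrier = {f. \<forall>u \<in> Poly_Mapping.keys f. Poly_Mapping.keys u \<subseteq> {1..m}},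
     monoid.mult = (*), one = 1, zero = 0, add = (+)\<rparr>"

definition var :: "nat \<Rightarrow> 'k::field mpoly" where
  "var i = Poly_Mapping.single (Poly_Mapping.single i 1) 1"

definition const_polys :: "'k::field mpoly set" where
  "const_polys = (\<lambda>c. Poly_Mapping.single 0 c) ` UNIV"

text \<open>The zero polynomial is homogeneous of every degree.\<close>

definition homog_polys :: "nat \<Rightarrow> 'k::field mpoly set" where
  "homog_polys d =
    {f. \<forall>u \<in> Poly_Mapping.keys f. (\<Sum>i \<in> Poly_Mapping.keys u. Poly_Mapping.lookup u i) = d}"


section \<open>Hilbert series and Hilbert depth\<close>

text \<open>
  A graded module is given by its family \<open>M\<close> of homogeneous components \<open>M d\<close>, which are
  \<open>k\<close>-subspaces of an ambient ring \<open>A\<close> containing the field \<open>k\<close>; \<^const>\<open>ring.dim\<close> is the dimension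
  over \<open>k\<close>. The modules needed here are ideals of a quotient ring and so live in degrees \<open>d \<ge> 0\<close>.
\<close>

definition hilbert_series ::
    "('a, 'b) ring_scheme \<Rightarrow> 'a set \<Rightarrow> (nat \<Rightarrow> 'a set) \<Rightarrow> int fps" where
  "hilbert_series A k M = Abs_fps (\<lambda>d. int (ring.dim A k (M d)))"

text \<open>
  The maximum is over a finite nonempty set as soon as the series is nonzero, see
  \<open>hdepth_set_finite\<close> and \<open>hdepth_set_nonempty\<close> below.
\<close>

definition hdepth ::
    "('a, 'b) ring_scheme \<Rightarrow> 'a set \<Rightarrow> (nat \<Rightarrow> 'a set) \<Rightarrow> nat" where
  "hdepth A k M =
    Max {r. \<forall>i. fps_nth ((1 - fps_X) ^ r * hilbert_series A k M) i \<ge> 0}"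

text \<open>
  For homogeneous ideals \<open>I \<subseteq> J\<close> of \<open>S = K[x\<^sub>1, \<dots>, x\<^sub>m]\<close>, the module \<open>J/I\<close> is the ideal of \<open>S/I\<close>
  whose component of degree \<open>d\<close> consists of the classes of the forms of degree \<open>d\<close> in \<open>J\<close>. The case
  \<open>J = S\<close> is \<open>S/I\<close> itself. The field \<open>K\<close> sits in \<open>S/I\<close> as the classes of the constants.
\<close>

definition quot_component ::
    "nat \<Rightarrow> 'k::field mpoly set \<Rightarrow> 'k mpoly set \<Rightarrow> nat \<Rightarrow> 'k mpoly set set" where
  "quot_component m J I d = (\<lambda>f. I +>\<^bsub>poly_ring m\<^esub> f) ` (J \<inter> homog_polys d)"

definition quot_scalars :: "nat \<Rightarrow> 'k::field mpoly set \<Rightarrow> 'k mpoly set set" where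
  "quot_scalars m I = (\<lambda>f. I +>\<^bsub>poly_ring m\<^esub> f) ` const_polys"

definition hdepth_quot :: "nat \<Rightarrow> 'k::field mpoly set \<Rightarrow> 'k mpoly set \<Rightarrow> nat" where
  "hdepth_quot m J I = hdepth (poly_ring m Quot I) (quot_scalars m I) (quot_component m J I)"


section \<open>The edge ideals of paths and cycles\<close>

definition path_ideal :: "nat \<Rightarrow> 'k::field mpoly set" where
  "path_ideal m = Idl\<^bsub>poly_ring m\<^esub> {var i * var (i + 1) | i. 1 \<le> i \<and> i < m}"

definition cycle_ideal :: "nat \<Rightarrow> 'k::field mpoly set" where
  "cycle_ideal m = path_ideal m <+>\<^bsub>poly_ring m\<^esub> Idl\<^bsub>poly_ring m\<^esub> {var m * var 1}"


section \<open>Well-definedness\<close>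

lemma poly_ring_cring: "cring (poly_ring m :: 'k::field mpoly ring)"
proof -
  let ?C = "carrier (poly_ring m :: 'k mpoly ring)"
  have C: "?C = {f. \<forall>u \<in> Poly_Mapping.keys f. Poly_Mapping.keys u \<subseteq> {1..m}}"
    by (simp add: poly_ring_def)
  have add: "f + g \<in> ?C" if "f \<in> ?C" "g \<in> ?C" for f g
    using that keys_add[of f g] unfolding C by blast
  have uminus: "- f \<in> ?C" if "f \<in> ?C" for f
    using that unfolding C by simp
  have mult: "f * g \<in> ?C" if "f \<in> ?C" "g \<in> ?C" for f g
  proof -
    have "Poly_Mapping.keys u \<subseteq> {1..m}" if u: "u \<in> Poly_Mapping.keys (f * g)" for u
    proof -
      obtain a b where "u = a + b" "a \<in> Poly_Mapping.keys f" "b \<in> Poly_Mapping.keys g"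
        using u keys_mult[of f g] by blast
      then show ?thesis
        using \<open>f \<in> ?C\<close> \<open>g \<in> ?C\<close> keys_add[of a b] unfolding C by blast
    qed
    then show ?thesis unfolding C by blast
  qed
  have zero: "0 \<in> ?C" and one: "1 \<in> ?C"
    unfolding C by (auto simp flip: single_one)
  have ops: "(\<oplus>\<^bsub>poly_ring m\<^esub>) = (+)" "\<zero>\<^bsub>poly_ring m\<^esub> = 0"
      "(\<otimes>\<^bsub>poly_ring m\<^esub>) = (*)" "\<one>\<^bsub>poly_ring m\<^esub> = 1"
    by (simp_all add: poly_ring_def)
  have ag: "abelian_group (poly_ring m :: 'k mpoly ring)"
  proof (rule abelian_groupI)
    fix f assume "f \<in> ?C"
    then show "\<exists>g \<in> ?C. g \<oplus>\<^bsub>poly_ring m\<^esub> f = \<zero>\<^bsub>poly_ring m\<^esub>"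
      unfolding ops by (intro bexI[of _ "- f"] uminus) simp_all
  next
    fix f g assume "f \<in> ?C" "g \<in> ?C"
    then show "f \<oplus>\<^bsub>poly_ring m\<^esub> g \<in> ?C"
      unfolding ops by (rule add)
  next
    show "\<zero>\<^bsub>poly_ring m\<^esub> \<in> ?C"
      unfolding ops by (rule zero)
  qed (simp_all add: ops add.assoc add.commute)
  have cm: "comm_monoid (poly_ring m :: 'k mpoly ring)"
  proof (rule comm_monoidI)
    fix f g assume "f \<in> ?C" "g \<in> ?C"
    then show "f \<otimes>\<^bsub>poly_ring m\<^esub> g \<in> ?C"
      unfolding ops by (rule mult)
  next
    show "\<one>\<^bsub>poly_ring m\<^esub> \<in> ?C"
      unfolding ops by (rule one)
  qed (simp_all add: ops mult.assoc mult.commute)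
  show ?thesis
    using ag cm by (rule cringI) (simp add: ops distrib_right)
qed

lemma hdepth_set_nonempty:
  "0 \<in> {r. \<forall>i. fps_nth ((1 - fps_X) ^ r * hilbert_series A k M) i \<ge> 0}"
  by (simp add: hilbert_series_def)

lemma hdepth_set_finite:
  assumes "hilbert_series A k M \<noteq> 0"
  shows "finite {r. \<forall>i. fps_nth ((1 - fps_X) ^ r * hilbert_series A k M) i \<ge> 0}"
proof -
  define H where "H = hilbert_series A k M"
  define s where "s = subdegree H"
  have "H \<noteq> 0" using assms by (simp add: H_def)
  then have "fps_nth H s \<noteq> 0" by (simp add: s_def)
  moreover have "fps_nth H s \<ge> 0" by (simp add: H_def hilbert_series_def)
  ultimately have pos: "fps_nth H s \<ge> 1" by linarith
  define P where "P r = (1 - fps_X) ^ r * H" for r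
  have P0: "P 0 = H" by (simp add: P_def)
  have P_Suc: "P (Suc r) = P r - fps_X * P r" for r
    by (simp add: P_def algebra_simps)
  have low: "fps_nth (P r) i = 0" if "i < s" for r i
    using that
  proof (induction r arbitrary: i)
    case 0
    then show ?case by (simp add: P0 s_def nth_less_subdegree_zero)
  next
    case (Suc r)
    then show ?case by (simp add: P_Suc)
  qed
  have lead: "fps_nth (P r) s = fps_nth H s" for r
    by (induction r) (simp_all add: P0 P_Suc low)
  have nxt: "fps_nth (P r) (Suc s) = fps_nth H (Suc s) - int r * fps_nth H s" for r
    by (induction r) (simp_all add: P0 P_Suc lead algebra_simps)
  have "int r \<le> fps_nth H (Suc s)" if "\<forall>i. fps_nth (P r) i \<ge> 0" for r
  proof -
    have "int r * fps_nth H s \<le> fps_nth H (Suc s)"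
      using that nxt[of r] by (metis diff_ge_0_iff_ge)
    moreover have "int r * 1 \<le> int r * fps_nth H s"
      using pos by (intro mult_left_mono) auto
    ultimately show ?thesis by linarith
  qed
  then have "{r. \<forall>i. fps_nth (P r) i \<ge> 0} \<subseteq> {..nat (fps_nth H (Suc s))}"
    by (intro subsetI) (metis atMost_iff mem_Collect_eq nat_int nat_mono)
  then show ?thesis
    unfolding P_def H_def using finite_subset by blast
qed

end

theory Submission
  imports Defs
begin

text \<open>
  The monomials of \<open>J\<^sub>n\<close> outside \<open>I\<^sub>n\<close> are those whose support contains \<open>1\<close> and \<open>n\<close> and is independent in the
  path \<open>1, \<dots>, n\<close>. Such a support avoids \<open>2\<close> and \<open>n - 1\<close>, so it consists of \<open>1\<close>, \<open>n\<close> and an arbitrary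
  independent set of the path \<open>3, \<dots>, n - 2\<close>, which has \<open>n - 4\<close> vertices. Letting the exponents of \<open>x\<^sub>1\<close> and
  \<open>x\<^sub>n\<close> range over the positive integers, the Hilbert series of \<open>J\<^sub>n/I\<^sub>n\<close> is \<open>t\<^sup>2/(1 - t)\<^sup>2\<close> times the Hilbert
  series \<open>H\<^bsub>n-4\<^esub>\<close> of the path ring with \<open>n - 4\<close> variables (\<open>cycle_path_series\<close>). The factor \<open>t\<^sup>2\<close> does not
  affect signs and \<open>(1 - t)\<^bsup>-2\<^esup>\<close> raises the Hilbert depth by two (\<open>Max_nonneg_shift\<close>).
  
  For the bound, set \<open>m = n - 4\<close>; then \<open>\<lceil>(n + 2)/3\<rceil> = 2 + \<lceil>m/3\<rceil>\<close>, and it suffices that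
  \<open>(1 - t)\<^bsup>\<lceil>m/3\<rceil>\<^esup> H\<^sub>m\<close> has nonnegative coefficients. Deciding whether an independent set contains the
  last vertex gives \<open>(1 - t) H\<^sub>m\<^sub>+\<^sub>1 = (1 - t) H\<^sub>m + t H\<^bsub>m-1\<^esub>\<close>, and from it a recursion for \<open>H\<^sub>m\<^sub>+\<^sub>4\<close> in terms of
  \<open>H\<^sub>m\<^sub>+\<^sub>1\<close> and \<open>H\<^sub>m\<close> that preserves this property (\<open>nonneg_fps_path_indep\<close>).
  
  What connects this with the modules is \<open>hilbert_series_quot\<close>: for ideals \<open>I \<subseteq> J\<close> that are
  determined by the supports of their monomials, the monomials of \<open>J\<close> outside \<open>I\<close> are a basis of \<open>J/I\<close>,
  so that Hilbert functions count monomials by supports and degrees.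
\<close>


section \<open>Counting monomials by their supports\<close>

definition mdeg :: "(nat \<Rightarrow>\<^sub>0 nat) \<Rightarrow> nat" where
  "mdeg u = (\<Sum>i \<in> Poly_Mapping.keys u. Poly_Mapping.lookup u i)"

text \<open>
  For a simplicial complex \<open>\<S>\<close> this is the Hilbert series of its Stanley--Reisner ring; for a difference of
  two upward closed families it is the Hilbert series of the quotient of two squarefree monomial ideals.
\<close>

definition support_series :: "nat set set \<Rightarrow> int fps" where
  "support_series \<S> = Abs_fps (\<lambda>d. int (card {u. Poly_Mapping.keys u \<in> \<S> \<and> mdeg u = d}))"

lemma keys_add_nat: "Poly_Mapping.keys (u + v) = Poly_Mapping.keys u \<union> Poly_Mapping.keys (v :: 'a \<Rightarrow>\<^sub>0 nat)"
  by (auto simp: in_keys_iff lookup_add)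

lemma mdeg_add: "mdeg (u + v) = mdeg u + mdeg v"
  unfolding mdeg_def by (rule setsum_keys_plus_distrib) auto

lemma mdeg_single: "mdeg (Poly_Mapping.single i k) = k"
  by (auto simp: mdeg_def)

lemma finite_monomials_degree:
  assumes "finite \<S>" "\<And>F. F \<in> \<S> \<Longrightarrow> finite F"
  shows "finite {u. Poly_Mapping.keys u \<in> \<S> \<and> mdeg u = d}"
proof -
  have fin: "finite (\<Union>\<S>)" using assms by auto
  have "Poly_Mapping.lookup ` {u. Poly_Mapping.keys u \<in> \<S> \<and> mdeg u = d}
      \<subseteq> {f. (\<forall>i. i \<in> \<Union>\<S> \<longrightarrow> f i \<in> {0..d}) \<and> (\<forall>i. i \<notin> \<Union>\<S> \<longrightarrow> f i = 0)}"
  proof (clarify, intro conjI allI impI)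
    fix u i assume u: "Poly_Mapping.keys u \<in> \<S>" "d = mdeg u"
    show "Poly_Mapping.lookup u i \<in> {0..mdeg u}"
    proof (cases "i \<in> Poly_Mapping.keys u")
      case True
      then have "Poly_Mapping.lookup u i \<le> mdeg u"
        unfolding mdeg_def by (intro member_le_sum) auto
      then show ?thesis by simp
    qed (simp add: in_keys_iff)
    assume "i \<notin> \<Union>\<S>"
    then show "Poly_Mapping.lookup u i = 0" using u by (auto simp: in_keys_iff)
  qed
  moreover have "finite {f. (\<forall>i. i \<in> \<Union>\<S> \<longrightarrow> f i \<in> {0..d}) \<and> (\<forall>i. i \<notin> \<Union>\<S> \<longrightarrow> f i = 0)}"
    using finite_set_of_finite_funs[OF fin, of "{0..d}" 0] by (simp add: all_conj_distrib)
  ultimately have "finite (Poly_Mapping.lookup ` {u. Poly_Mapping.keys u \<in> \<S> \<and> mdeg u = d})"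
    by (rule finite_subset)
  then show ?thesis
    by (rule finite_imageD) (simp add: inj_on_def poly_mapping.lookup_inject)
qed

lemma support_series_disjoint_Un:
  assumes "finite (\<S> \<union> \<T>)" "\<And>F. F \<in> \<S> \<union> \<T> \<Longrightarrow> finite F" "\<S> \<inter> \<T> = {}"
  shows "support_series (\<S> \<union> \<T>) = support_series \<S> + support_series \<T>"
proof (rule fps_ext)
  fix d
  have "{u. Poly_Mapping.keys u \<in> \<S> \<union> \<T> \<and> mdeg u = d} =
      {u. Poly_Mapping.keys u \<in> \<S> \<and> mdeg u = d} \<union> {u. Poly_Mapping.keys u \<in> \<T> \<and> mdeg u = d}" by auto
  moreover have "{u. Poly_Mapping.keys u \<in> \<S> \<and> mdeg u = d} \<inter> {u. Poly_Mapping.keys u \<in> \<T> \<and> mdeg u = d} = {}"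
    using assms(3) by auto
  ultimately show "fps_nth (support_series (\<S> \<union> \<T>)) d = fps_nth (support_series \<S> + support_series \<T>) d"
    using assms(1,2) by (simp add: support_series_def card_Un_disjoint finite_monomials_degree)
qed

text \<open>
  Multiplication by \<open>x\<^sub>i\<close> reaches each monomial divisible by \<open>x\<^sub>i\<close> exactly once: dividing it by
  \<open>x\<^sub>i\<close> either keeps \<open>i\<close> in the support or removes it.
\<close>

lemma image_mult_variable:
  assumes "i \<notin> \<Union>\<S>"
  shows "(\<lambda>u. u + Poly_Mapping.single i 1) `
      {u. Poly_Mapping.keys u \<in> \<S> \<union> insert i ` \<S> \<and> mdeg u = d} =
    {u. Poly_Mapping.keys u \<in> insert i ` \<S> \<and> mdeg u = Suc d}" (is "?L = ?R")
proof
  show "?L \<subseteq> ?R" by (auto simp: keys_add_nat mdeg_add mdeg_single)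
  show "?R \<subseteq> ?L"
  proof
    fix u assume u: "u \<in> ?R"
    then obtain F where F: "F \<in> \<S>" "Poly_Mapping.keys u = insert i F" by auto
    \<comment> \<open>\<open>v\<close> is \<open>u / x\<^sub>i\<close>.\<close>
    define v where "v = Poly_Mapping.update i (Poly_Mapping.lookup u i - 1) u"
    have "Poly_Mapping.lookup u i > 0" using F by (metis gr0I in_keys_iff insertI1)
    then have uv: "u = v + Poly_Mapping.single i 1"
      by (auto intro!: poly_mapping_eqI simp: v_def lookup_update lookup_add lookup_single when_def)
    have "Poly_Mapping.keys v = F \<or> Poly_Mapping.keys v = insert i F"
      using F assms unfolding v_def keys_update by auto
    moreover have "mdeg v = d" using u uv by (simp add: mdeg_add mdeg_single)
    ultimately show "u \<in> ?L" using uv F by auto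
  qed
qed

text \<open>
  Adding a vertex to every support multiplies the series by \<open>t/(1 - t) = t + t\<^sup>2 + \<dots>\<close>, the sum over the
  possible exponents of the new variable. The denominator is cleared to stay in \<open>int fps\<close>.
\<close>

lemma support_series_insert:
  assumes "finite \<S>" "\<And>F. F \<in> \<S> \<Longrightarrow> finite F" "i \<notin> \<Union>\<S>"
  shows "(1 - fps_X) * support_series (insert i ` \<S>) = fps_X * support_series \<S>"
proof -
  have "support_series (insert i ` \<S>) = fps_X * support_series (\<S> \<union> insert i ` \<S>)"
  proof (rule fps_ext)
    fix d
    show "fps_nth (support_series (insert i ` \<S>)) d = fps_nth (fps_X * support_series (\<S> \<union> insert i ` \<S>)) d"
    proof (cases d)
      case 0
      have "mdeg u \<noteq> 0" if "Poly_Mapping.keys u \<in> insert i ` \<S>" for u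
      proof -
        have "i \<in> Poly_Mapping.keys u" using that by auto
        then show ?thesis by (auto simp: mdeg_def in_keys_iff)
      qed
      then have "{u. Poly_Mapping.keys u \<in> insert i ` \<S> \<and> mdeg u = 0} = {}" by auto
      then show ?thesis by (simp only: 0 support_series_def fps_nth_Abs_fps fps_X_mult_nth) simp
    next
      case (Suc e)
      have "card {u. Poly_Mapping.keys u \<in> insert i ` \<S> \<and> mdeg u = Suc e} =
          card {u. Poly_Mapping.keys u \<in> \<S> \<union> insert i ` \<S> \<and> mdeg u = e}"
        unfolding image_mult_variable[OF assms(3), symmetric] by (rule card_image) (simp add: inj_on_def)
      then show ?thesis by (simp add: Suc support_series_def)
    qed
  qed
  also have "support_series (\<S> \<union> insert i ` \<S>) = support_series \<S> + support_series (insert i ` \<S>)"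
    using assms by (intro support_series_disjoint_Un) auto
  finally show ?thesis
    unfolding left_diff_distrib diff_eq_eq mult_1_left distrib_left .
qed


section \<open>Independent sets of a path\<close>

text \<open>
  The independent sets of the path on the vertices \<open>a + 1, \<dots>, a + m\<close>. The offset is needed because
  removing both ends of a path and their neighbours leaves a path that starts at the vertex 3.
\<close>

definition path_indep :: "nat \<Rightarrow> nat \<Rightarrow> nat set set" where
  "path_indep a m = {F. F \<subseteq> {a+1..a+m} \<and> (\<forall>i. \<not> (i \<in> F \<and> Suc i \<in> F))}"

lemma finite_path_indep: "finite (path_indep a m)" "F \<in> path_indep a m \<Longrightarrow> finite F"
  by (rule finite_subset[of _ "Pow {a+1..a+m}"]) (auto simp: path_indep_def intro: finite_subset)

text \<open>
  An independent set either avoids the last vertex, or contains it and then avoids the one before.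
  The truncated \<open>m - 1\<close> makes the rule hold for \<open>m = 0\<close>, where nothing but the new vertex is left.
\<close>

lemma path_indep_Suc:
  "path_indep a (Suc m) = path_indep a m \<union> insert (a + Suc m) ` path_indep a (m - 1)" (is "?L = ?R")
proof
  show "?L \<subseteq> ?R"
  proof
    fix F assume F: "F \<in> ?L"
    show "F \<in> ?R"
    proof (cases "a + Suc m \<in> F")
      case False
      then have "F \<in> path_indep a m" using F unfolding path_indep_def by (auto simp: le_Suc_eq)
      then show ?thesis by simp
    next
      case True
      let ?G = "F - {a + Suc m}"
      have "a + m \<notin> F" using F True unfolding path_indep_def by auto
      have "j \<in> {a+1..a+(m-1)}" if "j \<in> ?G" for j
      proof -
        have "a + 1 \<le> j" "j \<le> a + Suc m" "j \<noteq> a + Suc m" "j \<noteq> a + m"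
          using that F \<open>a + m \<notin> F\<close> unfolding path_indep_def by auto
        then show ?thesis by simp
      qed
      then have "?G \<subseteq> {a+1..a+(m-1)}" by blast
      then have "?G \<in> path_indep a (m - 1)" using F unfolding path_indep_def by auto
      moreover have "F = insert (a + Suc m) ?G" using True by auto
      ultimately show ?thesis by blast
    qed
  qed
  show "?R \<subseteq> ?L" by (fastforce simp: path_indep_def)
qed

lemma path_indep_0: "path_indep a 0 = {{}}" by (auto simp: path_indep_def)

lemma support_series_path_indep_0: "support_series (path_indep a 0) = 1"
proof (rule fps_ext)
  fix d
  have "{u. Poly_Mapping.keys u \<in> path_indep a 0 \<and> mdeg u = d} = (if d = 0 then {0} else {})"
    by (auto simp: path_indep_0 mdeg_def)
  then show "fps_nth (support_series (path_indep a 0)) d = fps_nth 1 d"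
    by (simp add: support_series_def)
qed

lemma support_series_path_indep_Suc:
  "(1 - fps_X) * support_series (path_indep a (Suc m)) =
     (1 - fps_X) * support_series (path_indep a m) + fps_X * support_series (path_indep a (m - 1))"
proof -
  have "support_series (path_indep a (Suc m)) =
      support_series (path_indep a m) + support_series (insert (a + Suc m) ` path_indep a (m - 1))"
    unfolding path_indep_Suc
    by (rule support_series_disjoint_Un) (auto simp: finite_path_indep path_indep_def intro: finite_subset)
  moreover have "(1 - fps_X) * support_series (insert (a + Suc m) ` path_indep a (m - 1)) =
      fps_X * support_series (path_indep a (m - 1))"
    by (rule support_series_insert) (auto simp: finite_path_indep path_indep_def)
  ultimately show ?thesis by (simp add: algebra_simps)
qed

lemma one_minus_X_cancel: "(1 - fps_X) * f = (1 - fps_X) * g \<Longrightarrow> f = g" for f g :: "int fps"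
proof -
  have "fps_nth (1 - fps_X :: int fps) 0 \<noteq> 0" by simp
  then have "(1 - fps_X :: int fps) \<noteq> 0" by (metis fps_zero_nth)
  then show "(1 - fps_X) * f = (1 - fps_X) * g \<Longrightarrow> f = g" by simp
qed

text \<open>
  Neither the recursion nor its initial value mentions the offset.
\<close>

lemma support_series_path_indep_shift: "support_series (path_indep a m) = support_series (path_indep b m)"
proof (induction m rule: less_induct)
  case (less m)
  show ?case
  proof (cases m)
    case 0
    then show ?thesis by (simp add: support_series_path_indep_0)
  next
    case (Suc k)
    have "(1 - fps_X) * support_series (path_indep a (Suc k)) = (1 - fps_X) * support_series (path_indep b (Suc k))"
      unfolding support_series_path_indep_Suc using Suc less[of k] less[of "k - 1"] by simp
    then show ?thesis unfolding Suc by (rule one_minus_X_cancel)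
  qed
qed

lemma support_series_path_indep_nonzero: "support_series (path_indep a m) \<noteq> 0"
proof -
  have "(0 :: nat \<Rightarrow>\<^sub>0 nat) \<in> {u. Poly_Mapping.keys u \<in> path_indep a m \<and> mdeg u = 0}"
    by (simp add: path_indep_def mdeg_def)
  moreover have "finite {u. Poly_Mapping.keys u \<in> path_indep a m \<and> mdeg u = 0}"
    by (rule finite_monomials_degree[OF finite_path_indep])
  ultimately have "card {u. Poly_Mapping.keys u \<in> path_indep a m \<and> mdeg u = 0} \<noteq> 0"
    using card_0_eq by blast
  then have "fps_nth (support_series (path_indep a m)) 0 \<noteq> 0" by (simp add: support_series_def)
  then show ?thesis by (metis fps_zero_nth)
qed


section \<open>Power series with nonnegative coefficients\<close>

definition nonneg_fps :: "int fps \<Rightarrow> bool" where "nonneg_fps f \<longleftrightarrow> (\<forall>i. fps_nth f i \<ge> 0)"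

lemma nonneg_fps_add: "nonneg_fps f \<Longrightarrow> nonneg_fps g \<Longrightarrow> nonneg_fps (f + g)"
  by (simp add: nonneg_fps_def)

lemma nonneg_fps_X_mult: "nonneg_fps (fps_X * f) \<longleftrightarrow> nonneg_fps f"
proof -
  have "fps_nth (fps_X * f) (Suc i) = fps_nth f i" for i by simp
  moreover have "fps_nth (fps_X * f) 0 = 0" by simp
  ultimately show ?thesis
    unfolding nonneg_fps_def by (metis not0_implies_Suc order_refl)
qed

text \<open>
  Division by \<open>1 - t\<close> replaces coefficients by their partial sums.
\<close>

lemma nonneg_fps_one_minus_X: 
  assumes "nonneg_fps ((1 - fps_X) * f)" shows "nonneg_fps f"
proof -
  have "fps_nth f i \<ge> 0" for i
  proof (induction i)
    case 0
    have "fps_nth ((1 - fps_X) * f) 0 = fps_nth f 0" by simp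
    then show ?case using assms unfolding nonneg_fps_def by metis
  next
    case (Suc i)
    have "fps_nth ((1 - fps_X) * f) (Suc i) = fps_nth f (Suc i) - fps_nth f i"
      by (simp add: left_diff_distrib)
    then show ?case using assms Suc unfolding nonneg_fps_def by (smt (verit))
  qed
  then show ?thesis by (simp add: nonneg_fps_def)
qed

lemma nonneg_fps_power_antimono:
  assumes "nonneg_fps ((1 - fps_X) ^ s * f)" "r \<le> s"
  shows "nonneg_fps ((1 - fps_X) ^ r * f)"
  using assms(2,1)
  by (induction rule: dec_induct) (auto simp: mult.assoc dest: nonneg_fps_one_minus_X)

text \<open>
  The exponent is \<open>\<lceil>m/3\<rceil>\<close>. Write \<open>H\<^sub>m\<close> for the series of the path with \<open>m\<close> vertices. Three applications of
  the recursion give \<open>(1 - t)\<^sup>2 H\<^bsub>k+4\<^esub> = (1 - t)(1 + t) H\<^bsub>k+1\<^esub> + t H\<^sub>k\<close>. Multiplied by \<open>(1 - t)\<^bsup>q\<^esup>\<close> with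
  \<open>q = k div 3\<close>, the left-hand side gets the exponent \<open>q + 2\<close> claimed for \<open>k + 4\<close>, while \<open>H\<^bsub>k+1\<^esub>\<close> gets the
  exponent \<open>q + 1\<close> claimed for \<open>k + 1\<close>, and \<open>H\<^sub>k\<close> the exponent \<open>q\<close>, which is at most the one claimed for \<open>k\<close>.
  So both summands are nonnegative by induction. The paths with at most three vertices are computed.
\<close>

lemma nonneg_fps_path_indep: "nonneg_fps ((1 - fps_X) ^ ((m + 2) div 3) * support_series (path_indep a m))"
proof (induction m rule: less_induct)
  case (less m)
  define H where "H k = support_series (path_indep a k)" for k
  have H0: "H 0 = 1" by (simp add: H_def support_series_path_indep_0)
  have rec: "(1 - fps_X) * H (Suc k) = (1 - fps_X) * H k + fps_X * H (k - 1)" for k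
    unfolding H_def by (rule support_series_path_indep_Suc)
  have H1: "(1 - fps_X) * H 1 = 1" using rec[of 0] by (simp add: H0)
  have H2: "(1 - fps_X) * H 2 = 1 + fps_X" 
    using rec[of 1] H0 H1 by (simp add: numeral_2_eq_2)
  have H3: "(1 - fps_X) * H 3 = 1 + fps_X + fps_X * H 1" 
    using rec[of 2] H2 by (simp add: eval_nat_numeral)
  have nn1: "nonneg_fps 1" and nnX: "nonneg_fps fps_X" by (auto simp: nonneg_fps_def fps_X_def)
  have nnH: "nonneg_fps (H k)" for k by (simp add: nonneg_fps_def H_def support_series_def)
  have "m = 0 \<or> m = 1 \<or> m = 2 \<or> m = 3 \<or> m \<ge> 4" by auto
  then have "nonneg_fps ((1 - fps_X) ^ ((m + 2) div 3) * H m)"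
  proof (elim disjE)
    assume "m \<ge> 4"
    then obtain k where m: "m = k + 4" using le_Suc_ex by (metis add.commute)
    have r3: "(1 - fps_X) * H (k + 4) = (1 - fps_X) * H (k + 3) + fps_X * H (k + 2)"
      using rec[of "k + 3"] by (simp add: eval_nat_numeral)
    have r2: "(1 - fps_X) * H (k + 3) = (1 - fps_X) * H (k + 2) + fps_X * H (k + 1)"
      using rec[of "k + 2"] by (simp add: eval_nat_numeral)
    have r1: "(1 - fps_X) * H (k + 2) = (1 - fps_X) * H (k + 1) + fps_X * H k"
      using rec[of "k + 1"] by (simp add: eval_nat_numeral)
    have key: "(1 - fps_X)^2 * H (k + 4) = (1 - fps_X) * H (k + 1) + fps_X * ((1 - fps_X) * H (k + 1)) + fps_X * H k"
    proof -
      have "(1 - fps_X)^2 * H (k + 4) = (1 - fps_X) * ((1 - fps_X) * H (k + 3)) + fps_X * ((1 - fps_X) * H (k + 2))"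
        by (simp add: power2_eq_square mult.assoc r3) (simp add: algebra_simps)
      also have "\<dots> = (1 - fps_X) * H (k + 2) + fps_X * ((1 - fps_X) * H (k + 1))"
        by (simp only: r2) (simp add: algebra_simps)
      also have "\<dots> = (1 - fps_X) * H (k + 1) + fps_X * ((1 - fps_X) * H (k + 1)) + fps_X * H k"
        by (simp only: r1) (simp add: algebra_simps)
      finally show ?thesis .
    qed
    have e: "(m + 2) div 3 = k div 3 + 2" using m by simp
    have e1: "(k + 1 + 2) div 3 = k div 3 + 1" by simp
    have "(1 - fps_X) ^ ((m + 2) div 3) * H m = (1 - fps_X) ^ (k div 3) * ((1 - fps_X)^2 * H (k + 4))"
      unfolding e power_add mult.assoc by (simp only: m)
    also have "\<dots> = (1 - fps_X) ^ (k div 3 + 1) * H (k + 1) + fps_X * ((1 - fps_X) ^ (k div 3 + 1) * H (k + 1))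
        + fps_X * ((1 - fps_X) ^ (k div 3) * H k)"
      unfolding key power_add by (simp add: algebra_simps)
    finally have eq: "(1 - fps_X) ^ ((m + 2) div 3) * H m = \<dots>" .
    have a: "nonneg_fps ((1 - fps_X) ^ (k div 3 + 1) * H (k + 1))"
      using less[of "k + 1"] m unfolding H_def e1 by simp
    have b: "nonneg_fps ((1 - fps_X) ^ (k div 3) * H k)"
      by (rule nonneg_fps_power_antimono[of "(k + 2) div 3"]) (use less[of k] m in \<open>auto simp: H_def intro: div_le_mono\<close>)
    show ?thesis unfolding eq using a b by (intro nonneg_fps_add) (simp_all add: nonneg_fps_X_mult)
  next
    assume "m = 0" then show ?thesis using nn1 by (simp add: H0)
  next
    assume "m = 1" then show ?thesis using nn1 H1 by simp
  next
    assume "m = 2" then show ?thesis using H2 nn1 nnX by (simp add: nonneg_fps_add)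
  next
    assume "m = 3" then show ?thesis using H3 nn1 nnX nnH[of 1] by (simp add: nonneg_fps_add nonneg_fps_X_mult)
  qed
  then show ?case by (simp add: H_def)
qed

text \<open>
  Powers of \<open>t\<close> only shift coefficients, so an exponent \<open>r\<close> is admissible for \<open>H\<close> iff \<open>s + r\<close> is for
  \<open>H'\<close>. Since \<open>0\<close> is admissible for \<open>H\<close>, the maximum for \<open>H'\<close> is at least \<open>s\<close>, hence of the form \<open>s + r\<close>.
\<close>

lemma Max_nonneg_shift:
  fixes H H' :: "int fps"
  assumes "finite {r. nonneg_fps ((1 - fps_X) ^ r * H)}" "finite {r. nonneg_fps ((1 - fps_X) ^ r * H')}"
  and "nonneg_fps H" "(1 - fps_X) ^ s * H' = fps_X ^ t * H"
  shows "Max {r. nonneg_fps ((1 - fps_X) ^ r * H')} = s + Max {r. nonneg_fps ((1 - fps_X) ^ r * H)}"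
    (is "Max ?A' = s + Max ?A")
proof -
  have X: "nonneg_fps (fps_X ^ t * f) \<longleftrightarrow> nonneg_fps f" for f
    by (induction t) (simp_all add: mult.assoc nonneg_fps_X_mult)
  have eq: "s + r \<in> ?A' \<longleftrightarrow> r \<in> ?A" for r
  proof -
    have "(1 - fps_X) ^ (s + r) * H' = (1 - fps_X) ^ r * ((1 - fps_X) ^ s * H')"
      by (simp add: power_add ac_simps)
    also have "\<dots> = fps_X ^ t * ((1 - fps_X) ^ r * H)" 
      unfolding assms(4) by (simp add: ac_simps)
    finally show ?thesis by (simp add: X)
  qed
  have "0 \<in> ?A" using assms(3) by simp
  then have "s \<in> ?A'" using eq[of 0] by simp
  show ?thesis
  proof (rule antisym)
    have "Max ?A' \<in> ?A'" using assms(2) \<open>s \<in> ?A'\<close> by (intro Max_in) blast+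
    moreover have "s \<le> Max ?A'" using assms(2) \<open>s \<in> ?A'\<close> by (intro Max_ge)
    ultimately have "Max ?A' - s \<in> ?A" using eq[of "Max ?A' - s"] by (simp only: le_add_diff_inverse)
    then have "Max ?A' - s \<le> Max ?A" using assms(1) by (intro Max_ge)
    then show "Max ?A' \<le> s + Max ?A" by linarith
    have "Max ?A \<in> ?A" using assms(1) \<open>0 \<in> ?A\<close> by (intro Max_in) blast+
    then have "s + Max ?A \<in> ?A'" using eq by blast
    then show "s + Max ?A \<le> Max ?A'" using assms(2) by (intro Max_ge)
  qed
qed


section \<open>Squarefree monomial ideals\<close>

text \<open>
  Every monomial ideal below is determined by which supports its monomials have, so it is recorded
  as a family of subsets of \<open>{1..m}\<close>. The ambient ring itself is the case \<open>Pow {1..m}\<close>.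
\<close>

definition supported_polys :: "nat set set \<Rightarrow> 'k::field mpoly set" where
  "supported_polys \<U> = {f. \<forall>u \<in> Poly_Mapping.keys f. Poly_Mapping.keys u \<in> \<U>}"

lemma carrier_poly_ring: "carrier (poly_ring m) = supported_polys (Pow {1..m})"
  by (simp add: poly_ring_def supported_polys_def)

lemma poly_ring_ops:
  "(\<oplus>\<^bsub>poly_ring m\<^esub>) = (+)" "\<zero>\<^bsub>poly_ring m\<^esub> = 0"
  "(\<otimes>\<^bsub>poly_ring m\<^esub>) = (*)" "\<one>\<^bsub>poly_ring m\<^esub> = 1"
  by (simp_all add: poly_ring_def)

lemma poly_ring_ring: "ring (poly_ring m)"
  using poly_ring_cring cring.axioms(1) by blast

lemma poly_ring_a_inv:
  assumes "f \<in> carrier (poly_ring m)"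
  shows "\<ominus>\<^bsub>poly_ring m\<^esub> f = - f"
proof -
  interpret ring "poly_ring m" by (rule poly_ring_ring)
  have "- f \<in> carrier (poly_ring m)" using assms by (simp add: carrier_poly_ring supported_polys_def)
  then show ?thesis using assms by (intro minus_equality) (simp_all add: poly_ring_ops)
qed

lemma supported_polys_mono: "\<U> \<subseteq> \<V> \<Longrightarrow> supported_polys \<U> \<subseteq> supported_polys \<V>"
  by (auto simp: supported_polys_def)

text \<open>
  Supports add up under multiplication of monomials, so the ideal property is closure of the family
  under passing to larger supports.
\<close>

lemma ideal_supported_polys:
  assumes "\<U> \<subseteq> Pow {1..m}" and up: "\<And>F G. F \<in> \<U> \<Longrightarrow> F \<subseteq> G \<Longrightarrow> G \<subseteq> {1..m} \<Longrightarrow> G \<in> \<U>"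
  shows "ideal (supported_polys \<U>) (poly_ring m)"
proof -
  interpret ring "poly_ring m" by (rule poly_ring_ring)
  note sub = supported_polys_mono[OF assms(1), folded carrier_poly_ring]
  have mult: "g * f \<in> supported_polys \<U>" if "f \<in> supported_polys \<U>" "g \<in> carrier (poly_ring m)" for f g
  proof -
    have "Poly_Mapping.keys u \<in> \<U>" if uk: "u \<in> Poly_Mapping.keys (g * f)" for u
    proof -
      obtain a b where u: "u = a + b" "a \<in> Poly_Mapping.keys g" "b \<in> Poly_Mapping.keys f"
        using subsetD[OF keys_mult uk] by blast
      then have "Poly_Mapping.keys b \<in> \<U>" "Poly_Mapping.keys a \<subseteq> {1..m}"
        using \<open>f \<in> _\<close> \<open>g \<in> _\<close> by (auto simp: supported_polys_def carrier_poly_ring)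
      then show ?thesis using assms(1) up[of "Poly_Mapping.keys b" "Poly_Mapping.keys u"]
        by (auto simp: u keys_add_nat)
    qed
    then show ?thesis by (simp add: supported_polys_def)
  qed
  show ?thesis
  proof (rule idealI[OF ring_axioms])
    show "subgroup (supported_polys \<U>) (add_monoid (poly_ring m))"
    proof (rule add.subgroupI)
      show "supported_polys \<U> \<noteq> {}" by (auto simp: supported_polys_def intro!: exI[of _ 0])
      show "\<ominus>\<^bsub>poly_ring m\<^esub> f \<in> supported_polys \<U>" if "f \<in> supported_polys \<U>" for f
        using that sub poly_ring_a_inv[of f m] by (auto simp: supported_polys_def)
      show "f \<oplus>\<^bsub>poly_ring m\<^esub> g \<in> supported_polys \<U>" if "f \<in> supported_polys \<U>" "g \<in> supported_polys \<U>" for f g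
        using that keys_add[of f g] by (auto simp: poly_ring_ops supported_polys_def)
    qed (rule sub)
  qed (use mult in \<open>simp_all add: poly_ring_ops mult.commute\<close>)
qed

text \<open>
  A polynomial is a \<open>K\<close>-linear combination of its monomials, so an ideal is bounded from below by the
  monomials that it contains.
\<close>

lemma supported_polys_minimal:
  assumes "ideal J (poly_ring m)" and "\<U> \<subseteq> Pow {1..m}"
    and mono: "\<And>u. Poly_Mapping.keys u \<in> \<U> \<Longrightarrow> Poly_Mapping.single u 1 \<in> J"
  shows "supported_polys \<U> \<subseteq> J"
proof
  interpret J: ideal J "poly_ring m" by (rule assms(1))
  fix f :: "'a mpoly"
  assume "f \<in> supported_polys \<U>"
  then show "f \<in> J"
  proof (induction f rule: update_induct)
    case const
    then show ?case using additive_subgroup.zero_closed[OF J.additive_subgroup_axioms] by (simp add: poly_ring_ops)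
  next
    case (update f u c)
    have eq: "Poly_Mapping.update u c f = Poly_Mapping.single 0 c * Poly_Mapping.single u 1 + f"
      using update(1) by (intro poly_mapping_eqI)
        (auto simp: mult_single lookup_update lookup_add lookup_single when_def in_keys_iff)
    have "f \<in> J" "Poly_Mapping.single u 1 \<in> J"
      using update by (auto simp: supported_polys_def keys_update intro: mono)
    moreover have "Poly_Mapping.single 0 c \<in> carrier (poly_ring m)"
      by (simp add: poly_ring_def)
    ultimately show ?case unfolding eq using J.I_l_closed additive_subgroup.a_closed[OF J.additive_subgroup_axioms]
      by (simp add: poly_ring_ops)
  qed
qed

lemma supported_polys_Un:
  assumes "ideal (supported_polys \<U> :: 'k::field mpoly set) (poly_ring m)"
    and "ideal (supported_polys \<V> :: 'k mpoly set) (poly_ring m)"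
    and "\<U> \<subseteq> Pow {1..m}" "\<V> \<subseteq> Pow {1..m}"
  shows "supported_polys \<U> <+>\<^bsub>poly_ring m\<^esub> supported_polys \<V> = (supported_polys (\<U> \<union> \<V>) :: 'k mpoly set)"
    (is "?I <+>\<^bsub>_\<^esub> ?J = ?S")
proof
  interpret ring "poly_ring m :: 'k mpoly ring" by (rule poly_ring_ring)
  show "?I <+>\<^bsub>poly_ring m\<^esub> ?J \<subseteq> ?S"
  proof
    fix f assume "f \<in> ?I <+>\<^bsub>poly_ring m\<^esub> ?J"
    then obtain g h where "g \<in> ?I" "h \<in> ?J" "f = g + h"
      by (auto simp: set_add_def' poly_ring_ops)
    then show "f \<in> ?S" using keys_add[of g h] by (auto simp: supported_polys_def)
  qed
  show "?S \<subseteq> ?I <+>\<^bsub>poly_ring m\<^esub> ?J"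
  proof (rule supported_polys_minimal[OF add_ideals[OF assms(1,2)]])
    fix u :: "nat \<Rightarrow>\<^sub>0 nat" assume u: "Poly_Mapping.keys u \<in> \<U> \<union> \<V>"
    let ?x = "Poly_Mapping.single u 1 :: 'k mpoly"
    have "0 \<in> ?I" "0 \<in> ?J" by (simp_all add: supported_polys_def)
    moreover have "?x \<in> ?I \<or> ?x \<in> ?J" using u by (auto simp: supported_polys_def)
    moreover have "?x = ?x + 0" "?x = 0 + ?x" by simp_all
    ultimately show "?x \<in> ?I <+>\<^bsub>poly_ring m\<^esub> ?J"
      unfolding set_add_def' poly_ring_ops by blast
  qed (use assms(3,4) in auto)
qed

definition sqfree_monomial :: "nat set \<Rightarrow> 'k::field mpoly" where
  "sqfree_monomial F = Poly_Mapping.single (\<Sum>i\<in>F. Poly_Mapping.single i 1) 1"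

lemma keys_sum_single: "finite F \<Longrightarrow> Poly_Mapping.keys (\<Sum>i\<in>F. Poly_Mapping.single i (1::nat)) = F"
  by (induction F rule: finite_induct) (simp_all add: keys_add_nat)

lemma sqfree_monomial_edge: "i \<noteq> j \<Longrightarrow> var i * var j = sqfree_monomial {i, j}"
  by (simp add: var_def mult_single sqfree_monomial_def)

lemma monomial_eq_mult_sqfree:
  assumes "finite F" "F \<subseteq> Poly_Mapping.keys u"
  obtains v where "Poly_Mapping.single u 1 = Poly_Mapping.single v 1 * sqfree_monomial F"
    "Poly_Mapping.keys v \<subseteq> Poly_Mapping.keys u"
proof -
  let ?e = "\<Sum>i\<in>F. Poly_Mapping.single i (1::nat)"
  have e: "Poly_Mapping.lookup ?e i \<le> Poly_Mapping.lookup u i" for i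
    using assms by (auto simp: lookup_sum lookup_single when_def in_keys_iff Suc_le_eq)
  have "u = (u - ?e) + ?e"
    using e by (intro poly_mapping_eqI) (simp add: lookup_add lookup_minus)
  moreover have "Poly_Mapping.keys (u - ?e) \<subseteq> Poly_Mapping.keys u"
    by (auto simp: in_keys_iff lookup_minus)
  ultimately show ?thesis
    using that[of "u - ?e"] by (simp add: sqfree_monomial_def mult_single)
qed

text \<open>
  A squarefree monomial divides another monomial iff its support is contained in the support of the
  other one; hence an ideal generated by squarefree monomials is seen on the supports alone.
\<close>

lemma genideal_sqfree_monomials:
  assumes "\<E> \<subseteq> Pow {1..m}"
  shows "Idl\<^bsub>poly_ring m\<^esub> (sqfree_monomial ` \<E> :: 'k::field mpoly set) = supported_polys {F. F \<subseteq> {1..m} \<and> (\<exists>E\<in>\<E>. E \<subseteq> F)}"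
    (is "?I = supported_polys ?U")
proof
  interpret ring "poly_ring m :: 'k mpoly ring" by (rule poly_ring_ring)
  have fin: "finite E" if "E \<in> \<E>" for E
    using that assms finite_subset[of E "{1..m}"] by auto
  have gens: "(sqfree_monomial ` \<E> :: 'k mpoly set) \<subseteq> supported_polys ?U"
  proof
    fix f :: "'k mpoly" assume "f \<in> sqfree_monomial ` \<E>"
    then obtain E where E: "E \<in> \<E>" "f = sqfree_monomial E" by blast
    then have "E \<subseteq> {1..m}" using assms by blast
    then show "f \<in> supported_polys ?U"
      using E keys_sum_single[OF fin[OF E(1)]] by (auto simp: sqfree_monomial_def supported_polys_def)
  qed
  show "?I \<subseteq> supported_polys ?U"
    by (rule genideal_minimal[OF ideal_supported_polys gens]) (blast intro: order_trans)+
  have sub: "(sqfree_monomial ` \<E> :: 'k mpoly set) \<subseteq> carrier (poly_ring m)"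
    using gens supported_polys_mono[of ?U "Pow {1..m}"] by (auto simp: carrier_poly_ring)
  interpret I: ideal ?I "poly_ring m" by (rule genideal_ideal[OF sub])
  show "supported_polys ?U \<subseteq> ?I"
  proof (rule supported_polys_minimal[OF I.is_ideal])
    fix u :: "nat \<Rightarrow>\<^sub>0 nat" assume "Poly_Mapping.keys u \<in> ?U"
    then obtain E where E: "E \<in> \<E>" "E \<subseteq> Poly_Mapping.keys u" and u: "Poly_Mapping.keys u \<subseteq> {1..m}" by auto
    obtain v where v: "Poly_Mapping.single u 1 = Poly_Mapping.single v 1 * (sqfree_monomial E :: 'k mpoly)"
      "Poly_Mapping.keys v \<subseteq> Poly_Mapping.keys u"
      using monomial_eq_mult_sqfree[OF fin[OF E(1)] E(2)] by blast
    have "(Poly_Mapping.single v 1 :: 'k mpoly) \<in> carrier (poly_ring m)"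
      using v(2) u by (simp add: poly_ring_def)
    moreover have "sqfree_monomial E \<in> ?I" using genideal_self[OF sub] E(1) by blast
    ultimately show "Poly_Mapping.single u (1::'k) \<in> ?I"
      unfolding v using I.I_l_closed by (simp add: poly_ring_ops)
  qed auto
qed


section \<open>Hilbert series of quotients of squarefree monomial ideals\<close>

lemma subfield_const_polys: "subfield const_polys (poly_ring m :: 'k::field mpoly ring)"
proof -
  interpret cring "poly_ring m :: 'k mpoly ring" by (rule poly_ring_cring)
  have sub: "const_polys \<subseteq> carrier (poly_ring m)" by (auto simp: const_polys_def poly_ring_def split: if_splits)
  have "subring const_polys (poly_ring m :: 'k mpoly ring)"
  proof (rule subringI[OF sub])
    show "\<one>\<^bsub>poly_ring m\<^esub> \<in> const_polys" 
      unfolding const_polys_def poly_ring_ops using single_one by (metis rangeI)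
  next
    fix h :: "'k mpoly" assume "h \<in> const_polys"
    then show "\<ominus>\<^bsub>poly_ring m\<^esub> h \<in> const_polys"
      using sub poly_ring_a_inv[of h m] by (auto simp: const_polys_def simp flip: single_uminus)
  qed (auto simp: const_polys_def poly_ring_ops mult_single simp flip: single_add)
  then have "subcring const_polys (poly_ring m :: 'k mpoly ring)" by (rule subcringI')
  moreover have "Units (poly_ring m \<lparr>carrier := const_polys\<rparr> :: 'k mpoly ring) = const_polys - {\<zero>\<^bsub>poly_ring m\<^esub>}"
  proof
    show "Units (poly_ring m \<lparr>carrier := const_polys\<rparr> :: 'k mpoly ring) \<subseteq> const_polys - {\<zero>\<^bsub>poly_ring m\<^esub>}"
      by (auto simp: Units_def poly_ring_ops poly_ring_def)
    show "const_polys - {\<zero>\<^bsub>poly_ring m\<^esub>} \<subseteq> Units (poly_ring m \<lparr>carrier := const_polys\<rparr> :: 'k mpoly ring)"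
    proof
      fix f assume "f \<in> const_polys - {\<zero>\<^bsub>poly_ring m :: 'k mpoly ring\<^esub>}"
      then obtain c :: 'k where f: "f = Poly_Mapping.single 0 c" "f \<noteq> 0"
        by (auto simp: const_polys_def poly_ring_ops)
      then have c: "f = Poly_Mapping.single 0 c" "c \<noteq> 0" by auto
      then have "f * Poly_Mapping.single 0 (inverse c) = 1" "Poly_Mapping.single 0 (inverse c) * f = 1"
        by (simp_all add: mult_single)
      then show "f \<in> Units (poly_ring m \<lparr>carrier := const_polys\<rparr>)"
        using c by (auto simp: Units_def poly_ring_ops const_polys_def poly_ring_def)
    qed
  qed
  ultimately show ?thesis by (rule subfieldI)
qed

text \<open>
  Distinct monomials are linearly independent: each new monomial adds one dimension, because the
  polynomials without it are the ones whose coefficient at it vanishes.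
\<close>

lemma dimension_span_monomials:
  assumes "finite D" "\<And>u. u \<in> D \<Longrightarrow> Poly_Mapping.keys u \<subseteq> {1..m}"
  shows "ring.dimension (poly_ring m) (card D) const_polys {f :: 'k::field mpoly. Poly_Mapping.keys f \<subseteq> D}"
proof -
  interpret ring "poly_ring m :: 'k mpoly ring" by (rule poly_ring_ring)
  show ?thesis using assms
  proof (induction D rule: finite_induct)
    case empty
    have "{f :: 'k mpoly. Poly_Mapping.keys f \<subseteq> {}} = {\<zero>\<^bsub>poly_ring m\<^esub>}" by (auto simp: poly_ring_ops)
    then show ?case using zero_dim by simp
  next
    case (insert u D)
    let ?E = "{f :: 'k mpoly. Poly_Mapping.keys f \<subseteq> D}" and ?x = "Poly_Mapping.single u 1 :: 'k mpoly"
    have "line_extension const_polys ?x ?E = {f. Poly_Mapping.keys f \<subseteq> insert u D}"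
    proof
      show "line_extension const_polys ?x ?E \<subseteq> {f. Poly_Mapping.keys f \<subseteq> insert u D}"
      proof
        fix f assume "f \<in> line_extension const_polys ?x ?E"
        then obtain c g where "Poly_Mapping.keys g \<subseteq> D" "f = Poly_Mapping.single u c + g"
          by (auto simp: line_extension_mem_iff const_polys_def poly_ring_ops mult_single)
        then show "f \<in> {f. Poly_Mapping.keys f \<subseteq> insert u D}"
          using keys_add[of "Poly_Mapping.single u c" g] by (auto split: if_splits)
      qed
      show "{f. Poly_Mapping.keys f \<subseteq> insert u D} \<subseteq> line_extension const_polys ?x ?E"
      proof
        fix f :: "'k mpoly" assume f: "f \<in> {f. Poly_Mapping.keys f \<subseteq> insert u D}"
        have "f = Poly_Mapping.single 0 (Poly_Mapping.lookup f u) * ?x + Poly_Mapping.update u 0 f"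
          by (intro poly_mapping_eqI) (auto simp: mult_single lookup_add lookup_single lookup_update when_def)
        moreover have "Poly_Mapping.update u 0 f \<in> ?E" using f by (auto simp: keys_update)
        ultimately show "f \<in> line_extension const_polys ?x ?E"
          unfolding line_extension_mem_iff poly_ring_ops const_polys_def by blast
      qed
    qed
    moreover have "?x \<in> carrier (poly_ring m)" "?x \<notin> ?E"
      using insert by (auto simp: poly_ring_def)
    moreover have "dimension (card D) const_polys ?E" using insert by auto
    ultimately show ?case using Suc_dim insert(1,2) by (metis card_insert_disjoint)
  qed
qed

lemma homog_polys_mdeg: "homog_polys d = {f. \<forall>u \<in> Poly_Mapping.keys f. mdeg u = d}"
  by (simp add: homog_polys_def mdeg_def)

lemma quot_one_zero:
  "\<one>\<^bsub>R Quot I\<^esub> = I +>\<^bsub>R\<^esub> \<one>\<^bsub>R\<^esub>" "\<zero>\<^bsub>R Quot I\<^esub> = I"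
  by (simp_all add: FactRing_def)

text \<open>
  The monomials of \<open>J\<close> outside \<open>I\<close> form a basis of \<open>J/I\<close>. In degree \<open>d\<close>, their span \<open>E\<close> meets \<open>I\<close> only
  in \<open>0\<close>, so the projection is injective on \<open>E\<close>; and each form in \<open>J\<close> is congruent modulo \<open>I\<close> to an element
  of \<open>E\<close>, by dropping its monomials in \<open>I\<close>. Properness of \<open>I\<close> keeps the constants a field in the quotient.
\<close>

lemma hilbert_series_quot:
  fixes \<U> \<V> :: "nat set set"
  defines "I \<equiv> supported_polys \<U> :: 'k::field mpoly set" and "J \<equiv> supported_polys \<V> :: 'k mpoly set"
  assumes sub: "\<U> \<subseteq> \<V>" "\<V> \<subseteq> Pow {1..m}" and I: "ideal I (poly_ring m)" and proper: "{} \<notin> \<U>"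
  shows "hilbert_series (poly_ring m Quot I) (quot_scalars m I) (quot_component m J I) = support_series (\<V> - \<U>)"
proof (rule fps_ext)
  fix d
  interpret ideal I "poly_ring m" by (rule I)
  interpret Q: ring "poly_ring m Quot I" by (rule quotient_is_ring)
  interpret h: ring_hom_ring "poly_ring m" "poly_ring m Quot I" "(+>\<^bsub>poly_ring m\<^esub>) I"
    by (rule rcos_ring_hom_ring)
  let ?h = "(+>\<^bsub>poly_ring m\<^esub>) I"
  define D where "D = {u. Poly_Mapping.keys u \<in> \<V> - \<U> \<and> mdeg u = d}"
  define E where "E = {f :: 'k mpoly. Poly_Mapping.keys f \<subseteq> D}"
  have "finite D" unfolding D_def
    by (rule finite_monomials_degree) (use sub in \<open>auto intro: finite_subset\<close>)
  have E: "E \<subseteq> carrier (poly_ring m)" using sub(2) by (auto simp: E_def D_def poly_ring_def)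
  have dimE: "dimension (card D) const_polys E"
    unfolding E_def by (rule dimension_span_monomials[OF \<open>finite D\<close>]) (use sub(2) in \<open>auto simp: D_def\<close>)
  have eq_iff: "?h f = ?h g \<longleftrightarrow> f - g \<in> I"
    if "f \<in> carrier (poly_ring m)" "g \<in> carrier (poly_ring m)" for f g
    using quotient_eq_iff_same_a_r_cos[OF I that] that poly_ring_a_inv[OF that(2)]
    by (simp add: a_minus_def poly_ring_ops)
  have inj: "inj_on ?h E"
  proof (rule inj_onI)
    fix f g assume fg: "f \<in> E" "g \<in> E" "?h f = ?h g"
    then have "f - g \<in> I" using eq_iff E by blast
    moreover have "Poly_Mapping.keys (f - g) \<subseteq> D"
      using fg keys_diff[of f g] by (auto simp: E_def)
    ultimately have "Poly_Mapping.keys (f - g) = {}"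
      by (auto simp: I_def supported_polys_def D_def simp del: keys_eq_empty)
    then show "f = g" by simp
  qed
  have "\<one>\<^bsub>poly_ring m\<^esub> \<notin> I" using proper by (simp add: I_def supported_polys_def poly_ring_ops)
  then have "?h \<one>\<^bsub>poly_ring m\<^esub> \<noteq> I"
    using rcos_const_imp_mem[OF one_closed] by blast
  then have one: "\<one>\<^bsub>poly_ring m Quot I\<^esub> \<noteq> \<zero>\<^bsub>poly_ring m Quot I\<^esub>"
    unfolding quot_one_zero .
  have img: "?h ` E = quot_component m J I d"
  proof
    show "?h ` E \<subseteq> quot_component m J I d"
      unfolding quot_component_def E_def J_def
      by (rule image_mono) (auto simp: D_def supported_polys_def homog_polys_mdeg)
    show "quot_component m J I d \<subseteq> ?h ` E"
    proof
      fix X assume "X \<in> quot_component m J I d"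
      then obtain f where f: "f \<in> J" "f \<in> homog_polys d" "X = ?h f"
        by (auto simp: quot_component_def)
      \<comment> \<open>The part of \<open>f\<close> outside \<open>I\<close>.\<close>
      define g where "g = Poly_Mapping.mapp (\<lambda>u c. c when Poly_Mapping.keys u \<notin> \<U>) f"
      have lg: "Poly_Mapping.lookup g u = (if Poly_Mapping.keys u \<in> \<U> then 0 else Poly_Mapping.lookup f u)" for u
        by (auto simp: g_def lookup_mapp when_def in_keys_iff)
      have gE: "g \<in> E"
        using f(1,2) by (auto simp: E_def D_def J_def supported_polys_def homog_polys_mdeg in_keys_iff lg split: if_splits)
      have "f - g \<in> I"
        by (auto simp: I_def supported_polys_def in_keys_iff lookup_minus lg split: if_splits)
      moreover have "f \<in> carrier (poly_ring m)"
        using f(1) sub(2) by (auto simp: J_def supported_polys_def poly_ring_def)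
      ultimately have "X = ?h g" using eq_iff gE E f(3) by blast
      then show "X \<in> ?h ` E" using gE by blast
    qed
  qed
  have "Q.dimension (card D) (quot_scalars m I) (quot_component m J I d)"
    using h.inj_hom_dimension[OF subfield_const_polys one inj dimE]
    unfolding img by (simp add: quot_scalars_def)
  moreover have "subfield (quot_scalars m I) (poly_ring m Quot I)"
    using h.img_is_subfield(2)[OF subfield_const_polys one] by (simp add: quot_scalars_def)
  ultimately have "Q.dim (quot_scalars m I) (quot_component m J I d) = card D"
    using Q.dimI by (simp add: over_def)
  then show "fps_nth (hilbert_series (poly_ring m Quot I) (quot_scalars m I) (quot_component m J I)) d =
      fps_nth (support_series (\<V> - \<U>)) d"
    by (simp add: hilbert_series_def support_series_def D_def)
qed


section \<open>The edge ideals of the path and the cycle\<close>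

lemma path_ideal_eq:
  "(path_ideal m :: 'k::field mpoly set) = supported_polys {F. F \<subseteq> {1..m} \<and> (\<exists>i. i \<in> F \<and> Suc i \<in> F)}"
proof -
  let ?E = "{{i, Suc i} | i. 1 \<le> i \<and> i < m}"
  have gens: "{var i * var (i + 1) | i. 1 \<le> i \<and> i < m} = (sqfree_monomial ` ?E :: 'k mpoly set)"
  proof -
    have "var i * var (i + 1) = (sqfree_monomial {i, Suc i} :: 'k mpoly)" for i
      by (simp add: sqfree_monomial_edge)
    then show ?thesis by (simp only: setcompr_eq_image image_image)
  qed
  have "Idl\<^bsub>poly_ring m\<^esub> (sqfree_monomial ` ?E :: 'k mpoly set) =
      supported_polys {F. F \<subseteq> {1..m} \<and> (\<exists>E\<in>?E. E \<subseteq> F)}"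
    by (rule genideal_sqfree_monomials) auto
  moreover have "{F. F \<subseteq> {1..m} \<and> (\<exists>E\<in>?E. E \<subseteq> F)} =
      {F. F \<subseteq> {1..m} \<and> (\<exists>i. i \<in> F \<and> Suc i \<in> F)}"
  proof (intro Collect_cong conj_cong refl iffI)
    fix F assume F: "F \<subseteq> {1..m}"
    show "\<exists>i. i \<in> F \<and> Suc i \<in> F" if "\<exists>E\<in>?E. E \<subseteq> F" using that by blast
    assume "\<exists>i. i \<in> F \<and> Suc i \<in> F"
    then obtain i where "i \<in> F" "Suc i \<in> F" by blast
    then have "{i, Suc i} \<subseteq> F" "1 \<le> i" "i < m" using F by auto
    then show "\<exists>E\<in>?E. E \<subseteq> F" by blast
  qed
  ultimately show ?thesis
    unfolding path_ideal_def gens by simp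
qed

lemma cycle_ideal_eq:
  assumes "2 \<le> m"
  shows "(cycle_ideal m :: 'k::field mpoly set) =
    supported_polys {F. F \<subseteq> {1..m} \<and> ((\<exists>i. i \<in> F \<and> Suc i \<in> F) \<or> {m, 1} \<subseteq> F)}"
proof -
  let ?U = "{F. F \<subseteq> {1..m} \<and> (\<exists>i. i \<in> F \<and> Suc i \<in> F)}" and ?V = "{F. F \<subseteq> {1..m} \<and> {m, 1} \<subseteq> F}"
  have V: "Idl\<^bsub>poly_ring m\<^esub> {var m * var 1} = (supported_polys ?V :: 'k mpoly set)"
    using genideal_sqfree_monomials[of "{{m, 1}}" m, where 'k = 'k] assms by (simp add: sqfree_monomial_edge)
  have "supported_polys ?U <+>\<^bsub>poly_ring m\<^esub> supported_polys ?V = (supported_polys (?U \<union> ?V) :: 'k mpoly set)"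
    by (intro supported_polys_Un ideal_supported_polys) auto
  moreover have "?U \<union> ?V = {F. F \<subseteq> {1..m} \<and> ((\<exists>i. i \<in> F \<and> Suc i \<in> F) \<or> {m, 1} \<subseteq> F)}" by auto
  ultimately show ?thesis
    unfolding cycle_ideal_def path_ideal_eq V by simp
qed

lemma ideal_path_supports:
  "ideal (supported_polys {F. F \<subseteq> {1..m} \<and> (\<exists>i. i \<in> F \<and> Suc i \<in> F)}) (poly_ring m)"
  by (rule ideal_supported_polys) auto

lemma hilbert_series_path:
  "hilbert_series (poly_ring m Quot path_ideal m) (quot_scalars m (path_ideal m))
     (quot_component m (carrier (poly_ring m) :: 'k::field mpoly set) (path_ideal m)) = support_series (path_indep 0 m)"
proof -
  have "Pow {1..m} - {F. F \<subseteq> {1..m} \<and> (\<exists>i. i \<in> F \<and> Suc i \<in> F)} = path_indep 0 m"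
    by (auto simp: path_indep_def)
  moreover have "hilbert_series (poly_ring m Quot path_ideal m) (quot_scalars m (path_ideal m))
     (quot_component m (supported_polys (Pow {1..m}) :: 'k mpoly set) (path_ideal m)) =
     support_series (Pow {1..m} - {F. F \<subseteq> {1..m} \<and> (\<exists>i. i \<in> F \<and> Suc i \<in> F)})"
    unfolding path_ideal_eq by (rule hilbert_series_quot[OF _ _ ideal_path_supports]) auto
  ultimately show ?thesis unfolding carrier_poly_ring by simp
qed

text \<open>
  A monomial of \<open>J\<^sub>n\<close> outside \<open>I\<^sub>n\<close> is divisible by \<open>x\<^sub>1x\<^sub>n\<close> and has independent support. It
  therefore avoids \<open>x\<^sub>2\<close> and \<open>x\<^bsub>n-1\<^esub>\<close>, and on the remaining path \<open>3, \<dots>, n - 2\<close> the only condition left is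
  independence.
\<close>

lemma cycle_minus_path_supports:
  assumes "n \<ge> 5"
  shows "{F. F \<subseteq> {1..n} \<and> ((\<exists>i. i \<in> F \<and> Suc i \<in> F) \<or> {n, 1} \<subseteq> F)}
      - {F. F \<subseteq> {1..n} \<and> (\<exists>i. i \<in> F \<and> Suc i \<in> F)} =
    insert 1 ` insert n ` path_indep 2 (n - 4)" (is "?L = ?R")
proof
  show "?L \<subseteq> ?R"
  proof
    fix F assume "F \<in> ?L"
    then have F: "F \<subseteq> {1..n}" "\<And>i. i \<in> F \<Longrightarrow> Suc i \<notin> F" "n \<in> F" "1 \<in> F" by auto
    let ?G = "F - {1, n}"
    have "2 \<notin> F" using F(2)[of 1] F(4) by (simp add: numeral_2_eq_2)
    moreover have "n - 1 \<notin> F" using F(2)[of "n - 1"] F(3) assms by auto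
    ultimately have "i \<in> {2 + 1..2 + (n - 4)}" if "i \<in> ?G" for i
    proof -
      have "i \<ge> 1" "i \<le> n" "i \<noteq> 1" "i \<noteq> n" "i \<noteq> 2" "i \<noteq> n - 1"
        using that F(1) \<open>2 \<notin> F\<close> \<open>n - 1 \<notin> F\<close> by auto
      then show ?thesis using assms by simp
    qed
    then have "?G \<in> path_indep 2 (n - 4)" using F(2) unfolding path_indep_def by blast
    moreover have "F = insert 1 (insert n ?G)" using F(3,4) by auto
    ultimately show "F \<in> ?R" by blast
  qed
  show "?R \<subseteq> ?L"
  proof
    fix F assume "F \<in> ?R"
    then obtain G where G: "F = insert 1 (insert n G)" "G \<subseteq> {2+1..2+(n-4)}"
        "\<And>i. i \<in> G \<Longrightarrow> Suc i \<notin> G"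
      unfolding path_indep_def by blast
    have bd: "3 \<le> i \<and> i + 2 \<le> n" if "i \<in> G" for i
      using subsetD[OF G(2) that] assms by auto
    have "\<not> (i \<in> F \<and> Suc i \<in> F)" for i
      using G(1) G(3)[of i] bd[of i] bd[of "Suc i"] assms by auto
    moreover have "F \<subseteq> {1..n}" using G(1) bd assms by fastforce
    moreover have "{n, 1} \<subseteq> F" using G(1) by auto
    ultimately show "F \<in> ?L" by blast
  qed
qed

lemma hilbert_series_cycle_path:
  assumes "n \<ge> 5"
  shows "hilbert_series (poly_ring n Quot path_ideal n) (quot_scalars n (path_ideal n))
     (quot_component n (cycle_ideal n :: 'k::field mpoly set) (path_ideal n)) =
     support_series (insert 1 ` insert n ` path_indep 2 (n - 4))"
proof -
  have "2 \<le> n" using assms by simp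
  show ?thesis
    unfolding cycle_ideal_eq[OF \<open>2 \<le> n\<close>] path_ideal_eq cycle_minus_path_supports[OF assms, symmetric]
    by (rule hilbert_series_quot[OF _ _ ideal_path_supports]) auto
qed

text \<open>
  The two end vertices contribute the factor \<open>(t/(1 - t))\<^sup>2\<close>.
\<close>

lemma cycle_path_series:
  assumes "n \<ge> 5"
  shows "(1 - fps_X) ^ 2 * support_series (insert 1 ` insert n ` path_indep 2 (n - 4)) =
    fps_X ^ 2 * support_series (path_indep 0 (n - 4))"
proof -
  let ?S = "path_indep 2 (n - 4)"
  have notin: "1 \<notin> F" "n \<notin> F" if "F \<in> ?S" for F
  proof -
    have "F \<subseteq> {2+1..2+(n-4)}" using that by (simp add: path_indep_def)
    then show "1 \<notin> F" "n \<notin> F" using assms by auto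
  qed
  have n: "(1 - fps_X) * support_series (insert n ` ?S) = fps_X * support_series ?S"
    by (rule support_series_insert) (use notin in \<open>auto simp: finite_path_indep\<close>)
  have "(1 - fps_X) * support_series (insert 1 ` insert n ` ?S) = fps_X * support_series (insert n ` ?S)"
  proof (rule support_series_insert)
    show "1 \<notin> \<Union> (insert n ` ?S)" using notin(1) assms by auto
  qed (auto simp: finite_path_indep)
  then have "(1 - fps_X) ^ 2 * support_series (insert 1 ` insert n ` ?S) =
      (1 - fps_X) * (fps_X * support_series (insert n ` ?S))"
    by (simp only: power2_eq_square mult.assoc)
  also have "\<dots> = fps_X * ((1 - fps_X) * support_series (insert n ` ?S))"
    by (rule mult.left_commute)
  also have "\<dots> = fps_X ^ 2 * support_series ?S"
    by (simp only: n power2_eq_square mult.assoc)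
  finally show ?thesis unfolding support_series_path_indep_shift[of 2 _ 0] .
qed


section \<open>Hilbert depth\<close>

theorem theorem3p18:
  fixes n :: nat
  assumes "n \<ge> 6"
  shows "hdepth_quot n (cycle_ideal n :: 'k::field mpoly set) (path_ideal n) =
           2 + hdepth_quot (n - 4) (carrier (poly_ring (n - 4)) :: 'k mpoly set) (path_ideal (n - 4))
       \<and> int (2 + hdepth_quot (n - 4) (carrier (poly_ring (n - 4)) :: 'k mpoly set) (path_ideal (n - 4)))
           \<ge> \<lceil>(real n + 2) / 3\<rceil>"
proof -
  define m where "m = n - 4"
  define H where "H = support_series (path_indep 0 m)"
  define H' where "H' = support_series (insert 1 ` insert n ` path_indep 2 m)"
  have H: "hilbert_series (poly_ring m Quot path_ideal m) (quot_scalars m (path_ideal m))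
     (quot_component m (carrier (poly_ring m) :: 'k mpoly set) (path_ideal m)) = H"
    unfolding H_def by (rule hilbert_series_path)
  have H': "hilbert_series (poly_ring n Quot path_ideal n) (quot_scalars n (path_ideal n))
     (quot_component n (cycle_ideal n :: 'k mpoly set) (path_ideal n)) = H'"
    unfolding H'_def m_def using assms by (intro hilbert_series_cycle_path) simp
  have HH': "(1 - fps_X) ^ 2 * H' = fps_X ^ 2 * H"
    unfolding H_def H'_def m_def using assms by (intro cycle_path_series) simp
  have "H \<noteq> 0" unfolding H_def by (rule support_series_path_indep_nonzero)
  then have "H' \<noteq> 0" using HH' by auto
  have fin: "finite {r. nonneg_fps ((1 - fps_X) ^ r * H)}"
    using hdepth_set_finite[of "poly_ring m Quot path_ideal m :: 'k mpoly set ring"] \<open>H \<noteq> 0\<close> 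
    unfolding nonneg_fps_def H[symmetric] by blast
  have fin': "finite {r. nonneg_fps ((1 - fps_X) ^ r * H')}"
    using hdepth_set_finite[of "poly_ring n Quot path_ideal n :: 'k mpoly set ring"] \<open>H' \<noteq> 0\<close> 
    unfolding nonneg_fps_def H'[symmetric] by blast
  have d: "hdepth_quot m (carrier (poly_ring m) :: 'k mpoly set) (path_ideal m) = Max {r. nonneg_fps ((1 - fps_X) ^ r * H)}"
    unfolding hdepth_quot_def hdepth_def H nonneg_fps_def ..
  have d': "hdepth_quot n (cycle_ideal n :: 'k mpoly set) (path_ideal n) = Max {r. nonneg_fps ((1 - fps_X) ^ r * H')}"
    unfolding hdepth_quot_def hdepth_def H' nonneg_fps_def ..
  have "nonneg_fps H" by (simp add: nonneg_fps_def H_def support_series_def)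
  from Max_nonneg_shift[OF fin fin' this HH']
  have eq: "hdepth_quot n (cycle_ideal n :: 'k mpoly set) (path_ideal n) =
      2 + hdepth_quot m (carrier (poly_ring m) :: 'k mpoly set) (path_ideal m)"
    unfolding d d' .
  \<comment> \<open>Here \<open>(m + 2) div 3 = \<lceil>m/3\<rceil>\<close>.\<close>
  have "(m + 2) div 3 \<le> hdepth_quot m (carrier (poly_ring m) :: 'k mpoly set) (path_ideal m)"
    unfolding d using fin nonneg_fps_path_indep[of m 0] by (intro Max_ge) (auto simp: H_def)
  moreover have "\<lceil>(real n + 2) / 3\<rceil> \<le> int (2 + (m + 2) div 3)"
  proof -
    have "n + 2 \<le> 3 * (2 + (m + 2) div 3)" using assms by (simp add: m_def)
    then have "(real n + 2) / 3 \<le> real (2 + (m + 2) div 3)" by (simp add: field_simps)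
    then show ?thesis by (simp add: ceiling_le_iff)
  qed
  ultimately have "\<lceil>(real n + 2) / 3\<rceil> \<le> int (2 + hdepth_quot m (carrier (poly_ring m) :: 'k mpoly set) (path_ideal m))"
    by linarith
  then show ?thesis using eq unfolding m_def by blast
qed

end
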